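(* For each length function $w$ on $E$ and each edge $\mathbf{e}\in E$ put $$L_{w,\mathbf{e}}(x):=\mathbb{E}^\gamma\sum_{y\in V}1_{\gamma_{xy}}(\mathbf{e})\,|\gamma_{xy}|_w\,\mu(y),\qquad x\in V.$$ Then the logarithmic Sobolev constant $c_{\rm LS}$ of $\mu$ satisfies $$c_{\rm LS}\le \inf_w\max_{\mathbf{e}\in E}\frac{1}{Q(\mathbf{e})w(\mathbf{e})}\Big({\rm Ent}_\mu(L_{w,\mathbf{e}})+\mu(L_{w,\mathbf{e}})\log(e^2+1)\Big),$$ where the infimum is taken over all length functions $w$ on $E$ and $e$ is Euler's number.
   Context: Setting: $G=(V,E)$ is a finite connected graph with vertex set $V$ and set of oriented edges $E\subset V^2\setminus\{(x,x):x\in V\}$, which is symmetric; $x\sim y$ means $(x,y)\in E$. Jump rates $q(x,y)\ge 0$ are given with $q(x,y)>0$ if and only if $x\sim y$, and $\mathcal{L}f(x)=\sum_y q(x,y)(f(y)-f(x))$. A probability measure $\mu$ on $V$ satisfies the detailed balance condition $Q(x,y):=\mu(x)q(x,y)=\mu(y)q(y,x)$ for all $(x,y)\in E$. For $\mathbf{e}=(x,y)\in E$ write $Q(\mathbf{e})=Q(x,y)$ and $D_{\mathbf{e}}f=f(y)-f(x)$. The Dirichlet form is $\mathcal{E}(f,f)=\frac12\sum_{\mathbf{e}\in E}(D_{\mathbf{e}}f)^2Q(\mathbf{e})$. Write $\mu(f)=\sum_x f(x)\mu(x)$ and, for $g\ge 0$ on $V$, ${\rm Ent}_\mu(g)=\mu(g\log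 g)-\mu(g)\log\mu(g)$ (with $0\log 0=0$). The log-Sobolev constant $c_{\rm LS}$ is the smallest $\alpha$ such that ${\rm Ent}_\mu(f^2)\le 2\alpha\,\mathcal{E}(f,f)$ for all $f:V\to\mathbb{R}$. A path $\gamma_{xy}$ from $x$ to $y$ is a family of edges $\{\mathbf{e}_1,\dots,\mathbf{e}_n\}$ with $\mathbf{e}_k=(x_{k-1},x_k)\in E$, $x_0=x$, $x_n=y$; it has no circle if all $x_0,\dots,x_n$ are different. A length function is a function $w:E\to(0,\infty)$ with $w(x,y)=w(y,x)$; the $w$-length of a path is $|\gamma_{xy}|_w=\sum_{\mathbf{e}\in\gamma_{xy}}w(\mathbf{e})$. For every $x\ne y$ in $V$, $\gamma_{xy}$ is a given random (possibly deterministic) path without circle from $x$ to $y$; $\gamma_{xx}=\emptyset$. $\mathbb{E}^\gamma$ is the expectation with respect to the random family $\{\gamma_{xy}:x,y\in V\}$, and $1_{\gamma_{xy}}(\mathbf{e})=1$ if $\mathbf{e}\in\gamma_{xy}$ and $0$ otherwise. *)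

theory Defs
  imports "HOL-Probability.Probability"
begin

text \<open>
  The vertex set is a finite type and the oriented edges form a relation \<open>E\<close> on it.
  A probability measure on a finite set is a \<^type>\<open>pmf\<close>.
\<close>

definition mean :: "'v::finite pmf \<Rightarrow> ('v \<Rightarrow> real) \<Rightarrow> real" where
  "mean \<mu> f = (\<Sum>x\<in>UNIV. f x * pmf \<mu> x)"

text \<open>The convention \<open>0 log 0 = 0\<close> holds automatically for the product \<open>t * ln t\<close> at \<open>t = 0\<close>.\<close>

definition Ent :: "'v::finite pmf \<Rightarrow> ('v \<Rightarrow> real) \<Rightarrow> real" where
  "Ent \<mu> g = mean \<mu> (\<lambda>x. g x * ln (g x)) - mean \<mu> g * ln (mean \<mu> g)"

definition edge_flow :: "('v \<Rightarrow> 'v \<Rightarrow> real) \<Rightarrow> 'v pmf \<Rightarrow> 'v \<times> 'v \<Rightarrow> real" where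
  "edge_flow q \<mu> e = pmf \<mu> (fst e) * q (fst e) (snd e)"

definition edge_diff :: "'v \<times> 'v \<Rightarrow> ('v \<Rightarrow> real) \<Rightarrow> real" where
  "edge_diff e f = f (snd e) - f (fst e)"

definition dirichlet ::
  "('v \<times> 'v) set \<Rightarrow> ('v \<Rightarrow> 'v \<Rightarrow> real) \<Rightarrow> 'v pmf \<Rightarrow> ('v \<Rightarrow> real) \<Rightarrow> real" where
  "dirichlet E q \<mu> f = 1 / 2 * (\<Sum>e\<in>E. (edge_diff e f)\<^sup>2 * edge_flow q \<mu> e)"

text \<open>
  On a graph with a single vertex every real \<open>\<alpha>\<close> is admissible, so that there is no least one;
  the value is meaningful only if there is at least one edge.
\<close>

definition log_sobolev_const ::
  "('v::finite \<times> 'v) set \<Rightarrow> ('v \<Rightarrow> 'v \<Rightarrow> real) \<Rightarrow> 'v pmf \<Rightarrow> real" where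
  "log_sobolev_const E q \<mu> =
     (LEAST \<alpha>. \<forall>f. Ent \<mu> (\<lambda>x. (f x)\<^sup>2) \<le> 2 * \<alpha> * dirichlet E q \<mu> f)"

text \<open>
  A path is the set of its oriented edges.  The vertices \<open>z 0, \<dots>, z n\<close> being different,
  the edges of a path without circle are different as well, so no multiplicity is lost.
\<close>

definition circle_free_path ::
  "('v \<times> 'v) set \<Rightarrow> 'v \<Rightarrow> 'v \<Rightarrow> ('v \<times> 'v) set \<Rightarrow> bool" where
  "circle_free_path E x y p \<longleftrightarrow>
     (\<exists>(n::nat) z. z 0 = x \<and> z n = y \<and> inj_on z {0..n} \<and>
        (\<forall>k\<in>{1..n}. (z (k - 1), z k) \<in> E) \<and> p = (\<lambda>k. (z (k - 1), z k)) ` {1..n})"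

text \<open>Only the values of a length function on \<open>E\<close> are constrained, and only these matter.\<close>

definition length_functions :: "('v \<times> 'v) set \<Rightarrow> ('v \<times> 'v \<Rightarrow> real) set" where
  "length_functions E = {w. \<forall>(x, y)\<in>E. w (x, y) > 0 \<and> w (x, y) = w (y, x)}"

definition path_length :: "('v \<times> 'v \<Rightarrow> real) \<Rightarrow> ('v \<times> 'v) set \<Rightarrow> real" where
  "path_length w p = (\<Sum>e\<in>p. w e)"

text \<open>
  The random family of paths is a map \<open>\<gamma>\<close> on a probability space \<open>M\<close>, where \<open>\<gamma> \<omega> x y\<close> is the
  path from \<open>x\<close> to \<open>y\<close> at the outcome \<open>\<omega>\<close>.
\<close>

definition expected_load ::
  "'w measure \<Rightarrow> ('w \<Rightarrow> 'v \<Rightarrow> 'v \<Rightarrow> ('v \<times> 'v) set) \<Rightarrow> 'v::finite pmf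
    \<Rightarrow> ('v \<times> 'v \<Rightarrow> real) \<Rightarrow> 'v \<times> 'v \<Rightarrow> 'v \<Rightarrow> real" where
  "expected_load M \<gamma> \<mu> w e x =
     (\<integral>\<omega>. (\<Sum>y\<in>UNIV. indicator (\<gamma> \<omega> x y) e * path_length w (\<gamma> \<omega> x y) * pmf \<mu> y) \<partial>M)"

end

theory Submission
  imports Defs "HOL-Real_Asymp.Real_Asymp"
begin

text \<open>
  The proof rests on the variational inequality for the entropy,
  \<open>\<mu>(u \<psi>) \<le> Ent(u) + \<mu>(u) log \<mu>(e\<^sup>\<psi>)\<close> for \<open>u \<ge> 0\<close> (\<open>mean_mult_le_Ent\<close>).

  Let \<open>g = f - \<mu>(f)\<close>.  Rothaus' lemma (\<open>Ent_shift_le\<close>) gives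
  \<open>Ent(f\<^sup>2) \<le> Ent(g\<^sup>2) + 2 \<mu>(g\<^sup>2)\<close>.  On the other hand, \<open>f(y) - f(x)\<close> is the sum of the increments
  of \<open>f\<close> along the path from \<open>x\<close> to \<open>y\<close>; Jensen's inequality over \<open>y\<close> and the Cauchy-Schwarz
  inequality along the path, with weights \<open>w\<close>, yield the pointwise bound
  \<open>g(x)\<^sup>2 \<le> \<Sum>\<^sub>e (D\<^sub>e f)\<^sup>2 / w(e) \<cdot> L\<^sub>e(x)\<close> (\<open>centered_square_le_loads\<close>).

  The entropy is not monotone, so that this bound cannot simply be inserted into \<open>Ent(g\<^sup>2)\<close>.
  However, \<open>Ent(g\<^sup>2) + 2 \<mu>(g\<^sup>2) \<le> \<mu>(g\<^sup>2 \<psi>)\<close> for some \<open>\<psi> \<ge> 0\<close> with \<open>\<mu>(e\<^sup>\<psi>) \<le> e\<^sup>2 + 1\<close>: the extremal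
  function \<open>log(g\<^sup>2/\<mu>(g\<^sup>2)) + 2\<close> is replaced by its positive part (\<open>Ent_plus_twice_mean_dual\<close>).
  As \<open>\<psi> \<ge> 0\<close>, the pointwise bound may be inserted into \<open>\<mu>(g\<^sup>2 \<psi>)\<close>, and the variational inequality
  applied to each \<open>\<mu>(L\<^sub>e \<psi>)\<close> produces \<open>Ent(L\<^sub>e) + \<mu>(L\<^sub>e) log(e\<^sup>2 + 1)\<close>.  The sum over \<open>e\<close> is then
  compared with the Dirichlet form edge by edge.
\<close>

section \<open>The variational inequality for the entropy\<close>

lemma mean_mono: "(\<And>x. f x \<le> g x) \<Longrightarrow> mean \<mu> f \<le> mean \<mu> g"
  unfolding mean_def by (intro sum_mono mult_right_mono) auto

lemma mean_nonneg: "(\<And>x. 0 \<le> f x) \<Longrightarrow> 0 \<le> mean \<mu> f"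
  unfolding mean_def by (intro sum_nonneg mult_nonneg_nonneg) auto

lemma mean_add: "mean \<mu> (\<lambda>x. f x + g x) = mean \<mu> f + mean \<mu> g"
  by (simp add: mean_def sum.distrib algebra_simps)

lemma mean_diff: "mean \<mu> (\<lambda>x. f x - g x) = mean \<mu> f - mean \<mu> g"
  by (simp add: mean_def sum_subtractf algebra_simps)

lemma mean_cmult: "mean \<mu> (\<lambda>x. c * f x) = c * mean \<mu> f"
  by (simp add: mean_def sum_distrib_left algebra_simps)

lemma mean_multc: "mean \<mu> (\<lambda>x. f x * c) = mean \<mu> f * c"
  by (simp only: mult.commute[of _ c] mean_cmult)

lemma mean_const: "mean \<mu> (\<lambda>x. c) = c"
  by (simp add: mean_def sum_distrib_left[symmetric] sum_pmf_eq_1)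

lemma mean_sum: "mean \<mu> (\<lambda>x. \<Sum>i\<in>I. f i x) = (\<Sum>i\<in>I. mean \<mu> (f i))"
  unfolding mean_def sum_distrib_right by (rule sum.swap)

lemma mean_pos: "(\<And>x. 0 < f x) \<Longrightarrow> 0 < mean \<mu> f"
proof -
  assume f: "\<And>x. 0 < f x"
  obtain x where x: "x \<in> set_pmf \<mu>"
    using set_pmf_not_empty by fast
  have "0 < f x * pmf \<mu> x"
    using f x by (simp add: pmf_positive)
  also have "\<dots> \<le> mean \<mu> f"
    unfolding mean_def using f by (intro member_le_sum) (auto simp: less_imp_le)
  finally show ?thesis .
qed

lemma mean_eq_0_imp:
  assumes "\<And>x. 0 \<le> u x" and "mean \<mu> u = 0"
  shows "u x * pmf \<mu> x = 0"
proof -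
  have "\<forall>x\<in>UNIV. u x * pmf \<mu> x = 0"
    using assms by (subst sum_nonneg_eq_0_iff[symmetric]) (auto simp: mean_def)
  then show ?thesis by blast
qed

lemma mean_mult_eq_0:
  assumes "\<And>x. 0 \<le> u x" and "mean \<mu> u = 0"
  shows "mean \<mu> (\<lambda>x. u x * h x) = 0"
proof -
  have "u x * h x * pmf \<mu> x = 0" for x
    using mean_eq_0_imp[OF assms, of x] by auto
  then show ?thesis unfolding mean_def by (intro sum.neutral) blast
qed

lemma Ent_eq_0:
  assumes "\<And>x. 0 \<le> u x" and "mean \<mu> u = 0"
  shows "Ent \<mu> u = 0"
  using mean_mult_eq_0[OF assms] assms(2) by (simp add: Ent_def)

text \<open>
  This is the nonnegativity of the relative entropy of the density \<open>u / \<mu>(u)\<close> with respect to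
  \<open>exp(\<psi>) / Z\<close>, \<open>Z = \<mu>(exp(\<psi>))\<close>.  It follows from \<open>log t \<le> t - 1\<close> at \<open>t = exp(\<psi>) \<mu>(u) / (u Z)\<close>,
  multiplied by \<open>u\<close> and averaged.
\<close>

lemma mean_mult_le_Ent:
  assumes u: "\<And>x. 0 \<le> u x"
  shows "mean \<mu> (\<lambda>x. u x * \<psi> x) \<le> Ent \<mu> u + mean \<mu> u * ln (mean \<mu> (\<lambda>x. exp (\<psi> x)))"
proof (cases "mean \<mu> u = 0")
  case True
  then show ?thesis
    using mean_mult_eq_0[OF u True] Ent_eq_0[OF u True] by simp
next
  case False
  define m where "m = mean \<mu> u"
  define Z where "Z = mean \<mu> (\<lambda>x. exp (\<psi> x))"
  have m: "m > 0"
    using False mean_nonneg[of u \<mu>] u by (simp add: m_def)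
  have Z: "Z > 0"
    unfolding Z_def by (rule mean_pos) simp
  have pw: "u x * \<psi> x - u x * ln (u x) + u x * (ln m - ln Z) \<le> exp (\<psi> x) * (m / Z) - u x" for x
  proof (cases "u x = 0")
    case True
    then show ?thesis using m Z by simp
  next
    case False
    then have ux: "u x > 0" using u[of x] by simp
    define t where "t = exp (\<psi> x) * (m / Z) / u x"
    have "t > 0" using ux m Z by (simp add: t_def)
    then have "u x * ln t \<le> u x * (t - 1)"
      using ux by (intro mult_left_mono ln_le_minus_one) auto
    moreover have "ln t = \<psi> x + (ln m - ln Z) - ln (u x)"
      using ux m Z by (simp add: t_def ln_div ln_mult)
    moreover have "u x * (t - 1) = exp (\<psi> x) * (m / Z) - u x"
      using ux by (simp add: t_def field_simps)
    ultimately show ?thesis by (simp add: algebra_simps)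
  qed
  have "mean \<mu> (\<lambda>x. u x * \<psi> x - u x * ln (u x) + u x * (ln m - ln Z))
        \<le> mean \<mu> (\<lambda>x. exp (\<psi> x) * (m / Z) - u x)"
    by (rule mean_mono) (rule pw)
  then have "mean \<mu> (\<lambda>x. u x * \<psi> x) - mean \<mu> (\<lambda>x. u x * ln (u x)) + m * (ln m - ln Z)
        \<le> Z * (m / Z) - m"
    by (simp only: mean_add mean_diff mean_multc m_def Z_def)
  then show ?thesis
    using Z by (simp add: Ent_def m_def Z_def algebra_simps)
qed

lemma Ent_nonneg: "(\<And>x. 0 \<le> u x) \<Longrightarrow> 0 \<le> Ent \<mu> u"
  using mean_mult_le_Ent[of u \<mu> "\<lambda>x. 0"] by (simp add: mean_const)

text \<open>
  Without the truncation at \<open>1\<close>, the function \<open>\<psi>\<close> below would be \<open>log(u / \<mu>(u)) + 2\<close>, with equality.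
  Truncation makes \<open>\<psi>\<close> nonnegative and increases \<open>\<mu>(e\<^sup>\<psi>) = e\<^sup>2\<close> by at most \<open>1\<close>.
\<close>

lemma Ent_plus_twice_mean_dual:
  assumes u: "\<And>x. 0 \<le> u x"
  obtains \<psi> where "\<And>x. 0 \<le> \<psi> x" and "mean \<mu> (\<lambda>x. exp (\<psi> x)) \<le> (exp 1)\<^sup>2 + 1"
    and "Ent \<mu> u + 2 * mean \<mu> u \<le> mean \<mu> (\<lambda>x. u x * \<psi> x)"
proof (cases "mean \<mu> u = 0")
  case True
  show ?thesis
    by (rule that[of "\<lambda>x. 0"]) (auto simp: mean_const True Ent_eq_0[OF u True])
next
  case False
  define m where "m = mean \<mu> u"
  have m: "m > 0"
    using False mean_nonneg[of u \<mu>] u by (simp add: m_def)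
  define \<rho> where "\<rho> x = max 1 ((exp 1)\<^sup>2 * (u x / m))" for x
  have \<rho>: "\<rho> x \<ge> 1" for x by (simp add: \<rho>_def)
  have \<rho>_pos: "\<rho> x > 0" for x using \<rho>[of x] by linarith
  show ?thesis
  proof (rule that[of "\<lambda>x. ln (\<rho> x)"])
    show "0 \<le> ln (\<rho> x)" for x using \<rho> by simp
    have "mean \<mu> (\<lambda>x. exp (ln (\<rho> x))) = mean \<mu> \<rho>"
      using \<rho>_pos by simp
    also have "\<dots> \<le> mean \<mu> (\<lambda>x. u x * ((exp 1)\<^sup>2 / m) + 1)"
      using u m by (intro mean_mono) (auto simp: \<rho>_def mult.commute intro: add_increasing2)
    also have "\<dots> = (exp 1)\<^sup>2 + 1"
      using m unfolding mean_add mean_multc mean_const by (simp add: m_def)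
    finally show "mean \<mu> (\<lambda>x. exp (ln (\<rho> x))) \<le> (exp 1)\<^sup>2 + 1" .
    have pw: "u x * ln (u x) + u x * (2 - ln m) \<le> u x * ln (\<rho> x)" for x
    proof (cases "u x = 0")
      case False
      then have ux: "u x > 0" using u[of x] by simp
      have "ln ((exp 1)\<^sup>2 * (u x / m)) \<le> ln (\<rho> x)"
        using ux m by (intro ln_mono) (auto simp: \<rho>_def)
      moreover have "ln ((exp 1)\<^sup>2 * (u x / m)) = 2 + (ln (u x) - ln m)"
        using ux m by (simp add: ln_mult ln_div ln_realpow)
      ultimately have "u x * (ln (u x) + (2 - ln m)) \<le> u x * ln (\<rho> x)"
        using ux by (intro mult_left_mono) auto
      then show ?thesis by (simp add: algebra_simps)
    qed simp
    have "Ent \<mu> u + 2 * mean \<mu> u = mean \<mu> (\<lambda>x. u x * ln (u x) + u x * (2 - ln m))"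
      unfolding mean_add mean_multc by (simp add: Ent_def m_def algebra_simps)
    also have "\<dots> \<le> mean \<mu> (\<lambda>x. u x * ln (\<rho> x))"
      by (rule mean_mono) (rule pw)
    finally show "Ent \<mu> u + 2 * mean \<mu> u \<le> mean \<mu> (\<lambda>x. u x * ln (\<rho> x))" .
  qed
qed

section \<open>Rothaus' lemma\<close>

lemma le_if_deriv_nonneg_except_finite:
  fixes h h' :: "real \<Rightarrow> real"
  assumes "a \<le> b" and "continuous_on {a..b} h" and "finite S"
    and deriv: "\<And>t. t \<in> {a<..<b} - S \<Longrightarrow> (h has_real_derivative h' t) (at t)"
    and nonneg: "\<And>t. t \<in> {a<..<b} - S \<Longrightarrow> 0 \<le> h' t"
  shows "h a \<le> h b"
proof -
  \<comment> \<open>The gauge integral ignores the values of the derivative on the exceptional set, so \<open>0\<close> will do there.\<close>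
  define k where "k t = (if t \<in> {a<..<b} - S then h' t else 0)" for t
  have "(k has_integral (h b - h a)) {a..b}"
  proof (rule fundamental_theorem_of_calculus_interior_strong[OF \<open>finite S\<close> \<open>a \<le> b\<close>])
    show "(h has_vector_derivative k t) (at t)" if "t \<in> {a<..<b} - S" for t
      using deriv[OF that] that by (simp add: k_def has_real_derivative_iff_has_vector_derivative)
  qed (fact assms)
  then have "0 \<le> h b - h a"
    by (rule has_integral_nonneg) (auto simp: k_def nonneg)
  then show ?thesis by simp
qed

lemma continuous_mult_ln_square: "continuous_on A (\<lambda>u::real. u * ln (u\<^sup>2))"
proof -
  have "isCont (\<lambda>u::real. u * ln (u\<^sup>2)) u" for u
  proof (cases "u = 0")
    case True
    have "((\<lambda>u::real. u * ln (u\<^sup>2)) \<longlongrightarrow> 0) (at_right 0)" by real_asymp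
    moreover have "((\<lambda>u::real. u * ln (u\<^sup>2)) \<longlongrightarrow> 0) (at_left 0)" by real_asymp
    ultimately show ?thesis
      using True by (simp add: isCont_def filterlim_split_at)
  next
    case False
    then show ?thesis by (intro continuous_intros) auto
  qed
  then show ?thesis by (simp add: continuous_at_imp_continuous_on)
qed

text \<open>
  Along the line \<open>a + t g\<close> the entropy of the square and its first derivative vanish at \<open>t = 0\<close>, and
  the second derivative is at most \<open>2 Ent(g\<^sup>2) + 4 \<mu>(g\<^sup>2)\<close>: up to a nonpositive term it is
  \<open>2 \<mu>(g\<^sup>2 log h) + 4 \<mu>(g\<^sup>2)\<close> for the probability density \<open>h\<close> proportional to \<open>(a + t g)\<^sup>2\<close>, and the
  variational inequality with \<open>\<psi> = log h\<close> bounds the first term.  Two integrations give the claim at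
  \<open>t = 1\<close>.  For \<open>a \<noteq> 0\<close> there are only finitely many \<open>t\<close> where \<open>a + t g\<close> vanishes somewhere and the
  logarithm is singular.
\<close>

lemma Ent_shift_le:
  assumes mg: "mean \<mu> g = 0"
  shows "Ent \<mu> (\<lambda>x. (a + g x)\<^sup>2) \<le> Ent \<mu> (\<lambda>x. (g x)\<^sup>2) + 2 * mean \<mu> (\<lambda>x. (g x)\<^sup>2)"
proof (cases "a = 0")
  case True
  then show ?thesis by (simp add: mean_nonneg)
next
  case a: False
  define s where "s = mean \<mu> (\<lambda>x. (g x)\<^sup>2)"
  define C where "C = Ent \<mu> (\<lambda>x. (g x)\<^sup>2) + 2 * s"
  define m where "m t = a\<^sup>2 + t\<^sup>2 * s" for t
  define v where "v t x = a + t * g x" for t x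
  define \<phi> where "\<phi> t = mean \<mu> (\<lambda>x. v t x * (v t x * ln ((v t x)\<^sup>2))) - m t * ln (m t)" for t
  define \<phi>1 where "\<phi>1 t = mean \<mu> (\<lambda>x. 2 * g x * (v t x * ln ((v t x)\<^sup>2))) - 2 * t * s * ln (m t)" for t
  define \<phi>2 where "\<phi>2 t = mean \<mu> (\<lambda>x. 2 * g x * (g x * ln ((v t x)\<^sup>2) + 2 * g x))
                          - (2 * s * ln (m t) + 2 * t * s * (2 * t * s / m t))" for t
  define S where "S = (\<Union>x. {t. v t x = 0})"
  have s: "s \<ge> 0" unfolding s_def by (rule mean_nonneg) simp
  have m: "m t > 0" for t using a s by (simp add: m_def add_pos_nonneg)
  have mean_v: "mean \<mu> (\<lambda>x. (v t x)\<^sup>2) = m t" for t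
  proof -
    have "mean \<mu> (\<lambda>x. (v t x)\<^sup>2) = mean \<mu> (\<lambda>x. a\<^sup>2 + (2 * a * t) * g x + t\<^sup>2 * (g x)\<^sup>2)"
      by (simp add: v_def power2_eq_square algebra_simps)
    also have "\<dots> = m t"
      by (simp only: mean_add mean_cmult mean_const mg) (simp add: m_def s_def)
    finally show ?thesis .
  qed
  have Ent_v: "Ent \<mu> (\<lambda>x. (v t x)\<^sup>2) = \<phi> t" for t
    unfolding Ent_def mean_v by (simp add: \<phi>_def power2_eq_square mult.assoc)
  have finS: "finite S"
  proof -
    have "S \<subseteq> range (\<lambda>x. - a / g x)"
    proof
      fix t assume "t \<in> S"
      then obtain x where x: "a + t * g x = 0" by (auto simp: S_def v_def)
      with a have "g x \<noteq> 0" by auto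
      with x have "t = - a / g x" by (simp add: field_simps)
      then show "t \<in> range (\<lambda>x. - a / g x)" by blast
    qed
    then show ?thesis by (rule finite_subset) simp
  qed
  have v_ln: "continuous_on A (\<lambda>t. v t x * ln ((v t x)\<^sup>2))" for A x
    by (rule continuous_on_compose2[OF continuous_mult_ln_square[of UNIV]])
       (auto simp: v_def intro!: continuous_intros)
  have m_ne: "m t \<noteq> 0" for t using m[of t] by simp
  have m_cont: "continuous_on A m" for A
    unfolding m_def by (intro continuous_intros)
  have v_cont: "continuous_on A (\<lambda>t. v t x)" for A x
    unfolding v_def by (intro continuous_intros)
  have cont: "continuous_on A \<phi>" for A
    unfolding \<phi>_def mean_def
    by (intro continuous_intros v_ln m_cont v_cont) (use m_ne in auto)
  have cont1: "continuous_on A \<phi>1" for A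
    unfolding \<phi>1_def mean_def
    by (intro continuous_intros v_ln m_cont) (use m_ne in auto)
  have dv: "((\<lambda>t. v t x) has_real_derivative g x) (at t)" for t x
    unfolding v_def by (auto intro!: derivative_eq_intros)
  have dm: "(m has_real_derivative 2 * t * s) (at t)" for t
    unfolding m_def by (auto intro!: derivative_eq_intros)
  have dvl: "((\<lambda>t. v t x * ln ((v t x)\<^sup>2)) has_real_derivative
      g x * ln ((v t x)\<^sup>2) + 2 * g x) (at t)" if "t \<notin> S" for t x
  proof -
    have "v t x \<noteq> 0" using that by (auto simp: S_def)
    then show ?thesis
      by (auto intro!: derivative_eq_intros dv) (simp add: field_simps power2_eq_square)
  qed
  have d: "(\<phi> has_real_derivative \<phi>1 t) (at t)" if t: "t \<notin> S" for t
  proof -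
    have "(\<phi> has_real_derivative
       (\<Sum>x\<in>UNIV. (g x * (v t x * ln ((v t x)\<^sup>2)) + (g x * ln ((v t x)\<^sup>2) + 2 * g x) * v t x) * pmf \<mu> x)
        - (2 * t * s * ln (m t) + (1 / m t * (2 * t * s)) * m t)) (at t)"
      unfolding \<phi>_def mean_def
      by (intro DERIV_diff DERIV_sum DERIV_cmult_right DERIV_mult dv dvl dm t DERIV_chain2[OF DERIV_ln_divide] m)
    moreover have "(\<Sum>x\<in>UNIV. (g x * (v t x * ln ((v t x)\<^sup>2)) + (g x * ln ((v t x)\<^sup>2) + 2 * g x) * v t x) * pmf \<mu> x)
       = mean \<mu> (\<lambda>x. 2 * g x * (v t x * ln ((v t x)\<^sup>2))) + 2 * t * s"
    proof -
      have "(\<Sum>x\<in>UNIV. (g x * (v t x * ln ((v t x)\<^sup>2)) + (g x * ln ((v t x)\<^sup>2) + 2 * g x) * v t x) * pmf \<mu> x)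
        = mean \<mu> (\<lambda>x. 2 * g x * (v t x * ln ((v t x)\<^sup>2)) + ((2 * a) * g x + (2 * t) * (g x)\<^sup>2))"
        unfolding mean_def by (intro sum.cong) (auto simp: v_def power2_eq_square algebra_simps)
      then show ?thesis by (simp only: mean_add mean_cmult mg) (simp add: s_def)
    qed
    ultimately show ?thesis
      using m_ne[of t] by (simp add: \<phi>1_def)
  qed
  have d1: "(\<phi>1 has_real_derivative \<phi>2 t) (at t)" if t: "t \<notin> S" for t
  proof -
    have "(\<phi>1 has_real_derivative
       (\<Sum>x\<in>UNIV. (2 * g x * (g x * ln ((v t x)\<^sup>2) + 2 * g x)) * pmf \<mu> x)
        - (2 * s * ln (m t) + (1 / m t * (2 * t * s)) * (2 * t * s))) (at t)"
      unfolding \<phi>1_def mean_def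
      by (intro DERIV_diff DERIV_sum DERIV_cmult_right DERIV_cmult DERIV_mult dvl dm t
            DERIV_chain2[OF DERIV_ln_divide] m)
         (auto intro!: derivative_eq_intros)
    then show ?thesis by (simp add: \<phi>2_def mean_def mult.commute)
  qed
  have d2: "\<phi>2 t \<le> 2 * C" if t: "t \<notin> S" for t
  proof -
    have vpos: "(v t x)\<^sup>2 > 0" for x using t by (auto simp: S_def)
    have "mean \<mu> (\<lambda>x. (g x)\<^sup>2 * ln ((v t x)\<^sup>2)) \<le> Ent \<mu> (\<lambda>x. (g x)\<^sup>2) + s * ln (m t)"
      using mean_mult_le_Ent[of "\<lambda>x. (g x)\<^sup>2" \<mu> "\<lambda>x. ln ((v t x)\<^sup>2)"] vpos
      by (simp add: mean_v s_def)
    moreover have "mean \<mu> (\<lambda>x. 2 * g x * (g x * ln ((v t x)\<^sup>2) + 2 * g x))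
       = 2 * mean \<mu> (\<lambda>x. (g x)\<^sup>2 * ln ((v t x)\<^sup>2)) + 4 * s"
    proof -
      have "mean \<mu> (\<lambda>x. 2 * g x * (g x * ln ((v t x)\<^sup>2) + 2 * g x))
        = mean \<mu> (\<lambda>x. 2 * ((g x)\<^sup>2 * ln ((v t x)\<^sup>2)) + 4 * (g x)\<^sup>2)"
        by (simp add: power2_eq_square algebra_simps)
      then show ?thesis by (simp only: mean_add mean_cmult s_def)
    qed
    moreover have "2 * t * s * (2 * t * s / m t) \<ge> 0"
    proof -
      have "2 * t * s * (2 * t * s / m t) = (2 * t * s)\<^sup>2 / m t" by (simp add: power2_eq_square)
      then show ?thesis using m[of t] by simp
    qed
    ultimately show ?thesis unfolding \<phi>2_def C_def by argo
  qed
  have \<phi>1_0: "\<phi>1 0 = 0"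
  proof -
    have "\<phi>1 0 = mean \<mu> (\<lambda>x. (2 * (a * ln (a\<^sup>2))) * g x)"
      by (simp add: \<phi>1_def v_def algebra_simps)
    then show ?thesis by (simp only: mean_cmult mg)
  qed
  have \<phi>_0: "\<phi> 0 = 0"
    by (simp add: \<phi>_def v_def mean_const m_def power2_eq_square)
  have \<phi>1_le: "\<phi>1 t \<le> 2 * C * t" if "0 \<le> t" for t
  proof -
    have "2 * C * 0 - \<phi>1 0 \<le> 2 * C * t - \<phi>1 t"
    proof (rule le_if_deriv_nonneg_except_finite[where a = 0 and b = t and S = S
          and h = "\<lambda>r. 2 * C * r - \<phi>1 r" and h' = "\<lambda>r. 2 * C - \<phi>2 r"])
      show "((\<lambda>r. 2 * C * r - \<phi>1 r) has_real_derivative 2 * C - \<phi>2 r) (at r)"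
        if "r \<in> {0<..<t} - S" for r
        using that by (auto intro!: derivative_eq_intros d1)
    qed (use that finS d2 in \<open>auto intro!: continuous_intros cont1\<close>)
    then show ?thesis by (simp add: \<phi>1_0)
  qed
  have "C * 0\<^sup>2 - \<phi> 0 \<le> C * 1\<^sup>2 - \<phi> 1"
  proof (rule le_if_deriv_nonneg_except_finite[where a = 0 and b = 1 and S = S
        and h = "\<lambda>r. C * r\<^sup>2 - \<phi> r" and h' = "\<lambda>r. 2 * C * r - \<phi>1 r"])
    show "((\<lambda>r. C * r\<^sup>2 - \<phi> r) has_real_derivative 2 * C * r - \<phi>1 r) (at r)"
      if "r \<in> {0<..<1} - S" for r
      using that by (auto intro!: derivative_eq_intros d)
  qed (use finS \<phi>1_le in \<open>auto intro!: continuous_intros cont\<close>)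
  then have "\<phi> 1 \<le> C" by (simp add: \<phi>_0)
  then show ?thesis
    using Ent_v[of 1] by (simp add: v_def C_def s_def)
qed

section \<open>Differences along random paths\<close>

lemma circle_free_path_subset: "circle_free_path E x y p \<Longrightarrow> p \<subseteq> E"
  by (auto simp: circle_free_path_def)

text \<open>Distinctness of the vertices makes the sum over the set of edges a sum over the steps.\<close>

lemma sum_edge_diff_path:
  assumes "circle_free_path E x y p"
  shows "(\<Sum>e\<in>p. edge_diff e f) = f y - f x"
proof -
  obtain n :: nat and z where z: "z 0 = x" "z n = y" "inj_on z {0..n}"
    and p: "p = (\<lambda>k. (z (k - 1), z k)) ` {1..n}"
    using assms by (auto simp: circle_free_path_def)
  have inj: "inj_on (\<lambda>k. (z (k - 1), z k)) {1..n}"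
    using z(3) by (auto simp: inj_on_def)
  have "(\<Sum>e\<in>p. edge_diff e f) = (\<Sum>k\<in>{1..n}. f (z k) - f (z (k - 1)))"
    unfolding p by (subst sum.reindex[OF inj]) (simp add: edge_diff_def)
  also have "\<dots> = f (z n) - f (z 0)"
    using sum_telescope''[of 0 n "\<lambda>k. f (z k)"] by (simp add: atLeastSucAtMost_greaterThanAtMost)
  finally show ?thesis by (simp add: z)
qed

lemma sum_squared_le_weighted:
  fixes d w :: "'a \<Rightarrow> real"
  assumes w: "\<And>e. e \<in> p \<Longrightarrow> w e > 0"
  shows "(\<Sum>e\<in>p. d e)\<^sup>2 \<le> (\<Sum>e\<in>p. w e) * (\<Sum>e\<in>p. (d e)\<^sup>2 / w e)"
proof -
  have "(\<Sum>e\<in>p. d e) = (\<Sum>e\<in>p. sqrt (w e) * (d e / sqrt (w e)))"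
  proof (rule sum.cong)
    show "d e = sqrt (w e) * (d e / sqrt (w e))" if "e \<in> p" for e
      using w[OF that] by simp
  qed simp
  then have "(\<Sum>e\<in>p. d e)\<^sup>2 \<le> (\<Sum>e\<in>p. (sqrt (w e))\<^sup>2) * (\<Sum>e\<in>p. (d e / sqrt (w e))\<^sup>2)"
    by (simp only: Cauchy_Schwarz_ineq_sum)
  also have "(\<Sum>e\<in>p. (sqrt (w e))\<^sup>2) = (\<Sum>e\<in>p. w e)"
    using w by (intro sum.cong) (auto simp: less_imp_le)
  also have "(\<Sum>e\<in>p. (d e / sqrt (w e))\<^sup>2) = (\<Sum>e\<in>p. (d e)\<^sup>2 / w e)"
    using w by (intro sum.cong) (auto simp: power_divide less_imp_le)
  finally show ?thesis .
qed

lemma mean_squared_le: "(mean \<mu> h)\<^sup>2 \<le> mean \<mu> (\<lambda>y. (h y)\<^sup>2)"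
proof -
  have "0 \<le> mean \<mu> (\<lambda>y. (h y - mean \<mu> h)\<^sup>2)" by (rule mean_nonneg) simp
  also have "\<dots> = mean \<mu> (\<lambda>y. (h y)\<^sup>2 - (2 * mean \<mu> h) * h y + (mean \<mu> h)\<^sup>2)"
    by (simp add: power2_eq_square algebra_simps)
  also have "\<dots> = mean \<mu> (\<lambda>y. (h y)\<^sup>2) - (mean \<mu> h)\<^sup>2"
    by (simp only: mean_add mean_diff mean_cmult mean_const) (simp add: power2_eq_square)
  finally show ?thesis by simp
qed

context
  fixes E :: "('v::finite \<times> 'v) set"
    and \<mu> :: "'v pmf"
    and M :: "'w measure"
    and \<gamma> :: "'w \<Rightarrow> 'v \<Rightarrow> 'v \<Rightarrow> ('v \<times> 'v) set"
    and w :: "'v \<times> 'v \<Rightarrow> real"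
  assumes prob: "prob_space M"
    and measurable_path: "\<And>x y. (\<lambda>\<omega>. \<gamma> \<omega> x y) \<in> measurable M (count_space UNIV)"
    and path: "\<And>\<omega> x y. \<omega> \<in> space M \<Longrightarrow> x \<noteq> y \<Longrightarrow> circle_free_path E x y (\<gamma> \<omega> x y)"
    and path_refl: "\<And>\<omega> x. \<omega> \<in> space M \<Longrightarrow> \<gamma> \<omega> x x = {}"
    and w_pos: "\<And>e. e \<in> E \<Longrightarrow> w e > 0"
begin

interpretation prob_space M by (fact prob)

lemma random_path_subset: "\<omega> \<in> space M \<Longrightarrow> \<gamma> \<omega> x y \<subseteq> E"
  using path circle_free_path_subset path_refl by (cases "x = y") fastforce+

lemma sum_edge_diff_random_path: "\<omega> \<in> space M \<Longrightarrow> (\<Sum>e\<in>\<gamma> \<omega> x y. edge_diff e f) = f y - f x"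
  using path path_refl sum_edge_diff_path by (cases "x = y") fastforce+

lemma path_length_random_path_nonneg: "\<omega> \<in> space M \<Longrightarrow> 0 \<le> path_length w (\<gamma> \<omega> x y)"
  unfolding path_length_def using random_path_subset w_pos
  by (intro sum_nonneg) (meson less_imp_le subsetD)

lemma expected_load_nonneg: "0 \<le> expected_load M \<gamma> \<mu> w e x"
  unfolding expected_load_def
  by (intro integral_nonneg_AE AE_I2 sum_nonneg mult_nonneg_nonneg path_length_random_path_nonneg)
     auto

lemma integrable_load:
  "integrable M (\<lambda>\<omega>. \<Sum>y\<in>UNIV. indicator (\<gamma> \<omega> x y) e * path_length w (\<gamma> \<omega> x y) * pmf \<mu> y)"
proof (rule Bochner_Integration.integrable_sum)
  fix y
  define F where "F p = indicator p e * path_length w p * pmf \<mu> y" for p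
  define B where "B = Max (range (\<lambda>p. norm (F p)))"
  have "integrable M (\<lambda>\<omega>. F (\<gamma> \<omega> x y))"
  proof (rule integrable_const_bound)
    show "AE \<omega> in M. norm (F (\<gamma> \<omega> x y)) \<le> B"
      unfolding B_def by (intro AE_I2 Max_ge) auto
    show "(\<lambda>\<omega>. F (\<gamma> \<omega> x y)) \<in> borel_measurable M"
      using measurable_path by (rule measurable_compose) simp
  qed
  then show "integrable M (\<lambda>\<omega>. indicator (\<gamma> \<omega> x y) e * path_length w (\<gamma> \<omega> x y) * pmf \<mu> y)"
    by (simp add: F_def)
qed

text \<open>
  The bound holds at every outcome, before the expectation is taken: Jensen's inequality in \<open>y\<close> and
  the weighted Cauchy-Schwarz inequality along each path.
\<close>

lemma centered_square_le_loads:
  "(f x - mean \<mu> f)\<^sup>2 \<le> (\<Sum>e\<in>E. (edge_diff e f)\<^sup>2 / w e * expected_load M \<gamma> \<mu> w e x)"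
proof -
  define load where "load \<omega> e =
    (\<Sum>y\<in>UNIV. indicator (\<gamma> \<omega> x y) e * path_length w (\<gamma> \<omega> x y) * pmf \<mu> y)" for \<omega> e
  have load_int: "integrable M (\<lambda>\<omega>. load \<omega> e)" for e
    unfolding load_def by (rule integrable_load)
  have pw: "(f x - mean \<mu> f)\<^sup>2 \<le> (\<Sum>e\<in>E. (edge_diff e f)\<^sup>2 / w e * load \<omega> e)"
    if \<omega>: "\<omega> \<in> space M" for \<omega>
  proof -
    have sq: "(f y - f x)\<^sup>2 \<le>
        (\<Sum>e\<in>E. (edge_diff e f)\<^sup>2 / w e * (indicator (\<gamma> \<omega> x y) e * path_length w (\<gamma> \<omega> x y)))" for y
    proof -
      have "(f y - f x)\<^sup>2 = (\<Sum>e\<in>\<gamma> \<omega> x y. edge_diff e f)\<^sup>2"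
        using \<omega> by (simp add: sum_edge_diff_random_path)
      also have "\<dots> \<le> path_length w (\<gamma> \<omega> x y) * (\<Sum>e\<in>\<gamma> \<omega> x y. (edge_diff e f)\<^sup>2 / w e)"
        unfolding path_length_def
        using random_path_subset[OF \<omega>] w_pos by (intro sum_squared_le_weighted) blast
      also have "\<dots> = (\<Sum>e\<in>\<gamma> \<omega> x y.
          (edge_diff e f)\<^sup>2 / w e * (indicator (\<gamma> \<omega> x y) e * path_length w (\<gamma> \<omega> x y)))"
        unfolding sum_distrib_left by (intro sum.cong) auto
      also have "\<dots> = (\<Sum>e\<in>E.
          (edge_diff e f)\<^sup>2 / w e * (indicator (\<gamma> \<omega> x y) e * path_length w (\<gamma> \<omega> x y)))"
        using random_path_subset[OF \<omega>] by (intro sum.mono_neutral_left) auto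
      finally show ?thesis .
    qed
    have "(f x - mean \<mu> f)\<^sup>2 = (mean \<mu> (\<lambda>y. f y - f x))\<^sup>2"
      by (simp only: mean_diff mean_const power2_commute)
    also have "\<dots> \<le> mean \<mu> (\<lambda>y. (f y - f x)\<^sup>2)"
      by (rule mean_squared_le)
    also have "\<dots> \<le> mean \<mu> (\<lambda>y. \<Sum>e\<in>E.
        (edge_diff e f)\<^sup>2 / w e * (indicator (\<gamma> \<omega> x y) e * path_length w (\<gamma> \<omega> x y)))"
      by (rule mean_mono) (rule sq)
    also have "\<dots> = (\<Sum>e\<in>E. (edge_diff e f)\<^sup>2 / w e * load \<omega> e)"
      by (simp only: mean_sum mean_cmult) (simp add: mean_def load_def)
    finally show ?thesis .
  qed
  have "(f x - mean \<mu> f)\<^sup>2 = (\<integral>\<omega>. (f x - mean \<mu> f)\<^sup>2 \<partial>M)"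
    by (simp add: prob_space)
  also have "\<dots> \<le> (\<integral>\<omega>. (\<Sum>e\<in>E. (edge_diff e f)\<^sup>2 / w e * load \<omega> e) \<partial>M)"
    by (intro integral_mono Bochner_Integration.integrable_sum integrable_mult_right load_int pw)
       auto
  also have "\<dots> = (\<Sum>e\<in>E. (edge_diff e f)\<^sup>2 / w e * (\<integral>\<omega>. load \<omega> e \<partial>M))"
    by (subst Bochner_Integration.integral_sum) (auto intro!: integrable_mult_right load_int)
  also have "\<dots> = (\<Sum>e\<in>E. (edge_diff e f)\<^sup>2 / w e * expected_load M \<gamma> \<mu> w e x)"
    by (simp add: expected_load_def load_def)
  finally show ?thesis .
qed

text \<open>
  The pointwise bound on the centered square is inserted after dualising the entropy with a
  nonnegative test function, and each load then receives its own entropy back.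
\<close>

lemma Ent_square_le_loads:
  "Ent \<mu> (\<lambda>x. (f x)\<^sup>2) \<le> (\<Sum>e\<in>E. (edge_diff e f)\<^sup>2 / w e *
      (Ent \<mu> (expected_load M \<gamma> \<mu> w e)
        + mean \<mu> (expected_load M \<gamma> \<mu> w e) * ln ((exp 1)\<^sup>2 + 1)))"
proof -
  define g where "g = (\<lambda>x. f x - mean \<mu> f)"
  define L where "L = expected_load M \<gamma> \<mu> w"
  have L: "0 \<le> L e x" for e x
    unfolding L_def by (rule expected_load_nonneg)
  have "mean \<mu> g = 0"
    by (simp add: g_def mean_diff mean_const)
  then have "Ent \<mu> (\<lambda>x. (f x)\<^sup>2) \<le> Ent \<mu> (\<lambda>x. (g x)\<^sup>2) + 2 * mean \<mu> (\<lambda>x. (g x)\<^sup>2)"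
    using Ent_shift_le[of \<mu> g "mean \<mu> f"] by (simp add: g_def)
  moreover obtain \<psi> where \<psi>: "\<And>x. 0 \<le> \<psi> x"
    and exp_\<psi>: "mean \<mu> (\<lambda>x. exp (\<psi> x)) \<le> (exp 1)\<^sup>2 + 1"
    and "Ent \<mu> (\<lambda>x. (g x)\<^sup>2) + 2 * mean \<mu> (\<lambda>x. (g x)\<^sup>2) \<le> mean \<mu> (\<lambda>x. (g x)\<^sup>2 * \<psi> x)"
    by (rule Ent_plus_twice_mean_dual[of "\<lambda>x. (g x)\<^sup>2" \<mu>]) auto
  ultimately have "Ent \<mu> (\<lambda>x. (f x)\<^sup>2) \<le> mean \<mu> (\<lambda>x. (g x)\<^sup>2 * \<psi> x)"
    by linarith
  also have "\<dots> \<le> mean \<mu> (\<lambda>x. (\<Sum>e\<in>E. (edge_diff e f)\<^sup>2 / w e * L e x) * \<psi> x)"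
    unfolding g_def L_def by (intro mean_mono mult_right_mono centered_square_le_loads \<psi>)
  also have "\<dots> = (\<Sum>e\<in>E. (edge_diff e f)\<^sup>2 / w e * mean \<mu> (\<lambda>x. L e x * \<psi> x))"
    by (simp only: sum_distrib_right mean_sum mean_cmult mult.assoc)
  also have "\<dots> \<le> (\<Sum>e\<in>E. (edge_diff e f)\<^sup>2 / w e *
      (Ent \<mu> (L e) + mean \<mu> (L e) * ln ((exp 1)\<^sup>2 + 1)))"
  proof (intro sum_mono mult_left_mono)
    fix e assume e: "e \<in> E"
    show "0 \<le> (edge_diff e f)\<^sup>2 / w e"
      using w_pos[OF e] by simp
    have "ln (mean \<mu> (\<lambda>x. exp (\<psi> x))) \<le> ln ((exp 1)\<^sup>2 + 1)"
      using exp_\<psi> by (intro ln_mono) (auto intro!: mean_pos)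
    then have "mean \<mu> (L e) * ln (mean \<mu> (\<lambda>x. exp (\<psi> x))) \<le> mean \<mu> (L e) * ln ((exp 1)\<^sup>2 + 1)"
      using L by (intro mult_left_mono mean_nonneg)
    then show "mean \<mu> (\<lambda>x. L e x * \<psi> x) \<le> Ent \<mu> (L e) + mean \<mu> (L e) * ln ((exp 1)\<^sup>2 + 1)"
      using mean_mult_le_Ent[of "L e" \<mu> \<psi>] L by simp
  qed
  finally show ?thesis by (simp add: L_def)
qed

end

section \<open>The logarithmic Sobolev constant\<close>

text \<open>
  The least admissible \<open>\<alpha>\<close> exists as soon as some \<open>\<alpha>\<close> is admissible: the admissible set is an
  intersection of closed half-lines, and the indicator function of an end point of an edge bounds it
  from below.
\<close>

lemma log_sobolev_const_le:
  fixes E :: "('v::finite \<times> 'v) set"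
  assumes irrefl: "irrefl E" and edge: "E \<noteq> {}"
    and Q: "\<And>e. e \<in> E \<Longrightarrow> edge_flow q \<mu> e > 0"
    and B: "\<And>f. Ent \<mu> (\<lambda>x. (f x)\<^sup>2) \<le> 2 * B * dirichlet E q \<mu> f"
  shows "log_sobolev_const E q \<mu> \<le> B"
proof -
  define A where "A = {\<alpha>. \<forall>f. Ent \<mu> (\<lambda>x. (f x)\<^sup>2) \<le> 2 * \<alpha> * dirichlet E q \<mu> f}"
  have mem_A: "\<alpha> \<in> A \<longleftrightarrow> (\<forall>f. Ent \<mu> (\<lambda>x. (f x)\<^sup>2) \<le> 2 * \<alpha> * dirichlet E q \<mu> f)" for \<alpha>
    by (simp add: A_def)
  have dir_nonneg: "0 \<le> dirichlet E q \<mu> f" for f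
    unfolding dirichlet_def using Q by (auto intro!: sum_nonneg mult_nonneg_nonneg simp: less_imp_le)
  obtain x y where xy: "(x, y) \<in> E" using edge by auto
  then have "x \<noteq> y" using irrefl by (auto simp: irrefl_def)
  define f0 where "f0 = (indicator {y} :: 'v \<Rightarrow> real)"
  have "0 < (edge_diff (x, y) f0)\<^sup>2 * edge_flow q \<mu> (x, y)"
    using Q[OF xy] \<open>x \<noteq> y\<close> by (simp add: edge_diff_def f0_def)
  also have "\<dots> \<le> (\<Sum>e\<in>E. (edge_diff e f0)\<^sup>2 * edge_flow q \<mu> e)"
    using xy Q by (intro member_le_sum) (auto simp: less_imp_le)
  finally have dir0: "0 < dirichlet E q \<mu> f0" by (simp add: dirichlet_def)
  have lower: "0 \<le> \<alpha>" if "\<alpha> \<in> A" for \<alpha>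
  proof -
    have "0 \<le> 2 * \<alpha> * dirichlet E q \<mu> f0"
      using that Ent_nonneg[of "\<lambda>x. (f0 x)\<^sup>2" \<mu>]
      by (auto simp: mem_A dest: spec[of _ f0])
    then show ?thesis using dir0 by (simp add: zero_le_mult_iff)
  qed
  have bdd: "bdd_below A" using lower by (rule bdd_belowI)
  have BA: "B \<in> A" using B by (simp add: mem_A)
  have Inf_A: "Inf A \<in> A"
    unfolding mem_A
  proof (intro allI)
    fix f
    show "Ent \<mu> (\<lambda>x. (f x)\<^sup>2) \<le> 2 * Inf A * dirichlet E q \<mu> f"
    proof (cases "dirichlet E q \<mu> f = 0")
      case True
      then show ?thesis using B[of f] by simp
    next
      case False
      then have pos: "0 < dirichlet E q \<mu> f" using dir_nonneg[of f] by simp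
      have "Ent \<mu> (\<lambda>x. (f x)\<^sup>2) / (2 * dirichlet E q \<mu> f) \<le> Inf A"
      proof (rule cInf_greatest)
        show "A \<noteq> {}" using BA by blast
        show "Ent \<mu> (\<lambda>x. (f x)\<^sup>2) / (2 * dirichlet E q \<mu> f) \<le> \<alpha>" if "\<alpha> \<in> A" for \<alpha>
          using that pos by (auto simp: mem_A field_simps)
      qed
      then show ?thesis using pos by (simp add: field_simps)
    qed
  qed
  have "log_sobolev_const E q \<mu> = Inf A"
    unfolding log_sobolev_const_def mem_A[symmetric]
    by (rule Least_equality) (use Inf_A cInf_lower bdd in auto)
  also have "\<dots> \<le> B" using BA bdd by (rule cInf_lower)
  finally show ?thesis .
qed

text \<open>Detailed balance spreads positivity of \<open>\<mu>\<close> from a point of its support along the edges.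
  This makes the flows \<open>Q(e)\<close> in the denominators of the bound positive.\<close>

lemma pmf_pos_of_detailed_balance:
  fixes E :: "('v::finite \<times> 'v) set"
  assumes "sym E" and connected: "\<And>x y. (x, y) \<in> E\<^sup>*"
    and q_pos: "\<And>x y. (x, y) \<in> E \<Longrightarrow> q x y > 0"
    and balance: "\<And>x y. (x, y) \<in> E \<Longrightarrow> pmf \<mu> x * q x y = pmf \<mu> y * q y x"
  shows "pmf \<mu> y > 0"
proof -
  obtain x where x: "pmf \<mu> x > 0"
    using set_pmf_not_empty[of \<mu>] pmf_positive by fast
  show ?thesis
    using connected[of x y]
  proof (induction rule: rtrancl_induct)
    case (step y z)
    then have "pmf \<mu> z * q z y > 0"
      using balance[of y z] q_pos[of y z] by (metis mult_pos_pos)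
    moreover have "q z y > 0"
      using step.hyps(2) \<open>sym E\<close> q_pos by (meson symD)
    ultimately show ?case by (simp add: zero_less_mult_iff)
  qed (fact x)
qed

theorem theorem2p1:
  fixes E :: "('v::finite \<times> 'v) set"
    and q :: "'v \<Rightarrow> 'v \<Rightarrow> real"
    and \<mu> :: "'v pmf"
    and M :: "'w measure"
    and \<gamma> :: "'w \<Rightarrow> 'v \<Rightarrow> 'v \<Rightarrow> ('v \<times> 'v) set"
  assumes "irrefl E" and "sym E"
    and connected: "\<And>x y. (x, y) \<in> E\<^sup>*"
    and edge: "E \<noteq> {}"
    and "\<And>x y. q x y \<ge> 0"
    and "\<And>x y. q x y > 0 \<longleftrightarrow> (x, y) \<in> E"
    and detailed_balance: "\<And>x y. (x, y) \<in> E \<Longrightarrow> pmf \<mu> x * q x y = pmf \<mu> y * q y x"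
    and "prob_space M"
    and "\<And>x y. (\<lambda>\<omega>. \<gamma> \<omega> x y) \<in> measurable M (count_space UNIV)"
    and "\<And>\<omega> x y. \<omega> \<in> space M \<Longrightarrow> x \<noteq> y \<Longrightarrow> circle_free_path E x y (\<gamma> \<omega> x y)"
    and "\<And>\<omega> x. \<omega> \<in> space M \<Longrightarrow> \<gamma> \<omega> x x = {}"
  shows "log_sobolev_const E q \<mu> \<le>
    (INF w\<in>length_functions E. Max ((\<lambda>e. 1 / (edge_flow q \<mu> e * w e) *
        (Ent \<mu> (expected_load M \<gamma> \<mu> w e)
          + mean \<mu> (expected_load M \<gamma> \<mu> w e) * ln ((exp 1)\<^sup>2 + 1))) ` E))"
proof (rule cINF_greatest)
  have "(\<lambda>_. 1) \<in> length_functions E" by (auto simp: length_functions_def)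
  then show "length_functions E \<noteq> {}" by blast
next
  fix w assume "w \<in> length_functions E"
  then have w: "w e > 0" if "e \<in> E" for e
    using that by (cases e) (auto simp: length_functions_def)
  have "pmf \<mu> x > 0" for x
    by (rule pmf_pos_of_detailed_balance[OF assms(2) connected _ detailed_balance])
      (use assms(6) in blast)
  then have Q: "edge_flow q \<mu> e > 0" if "e \<in> E" for e
    using that assms(6) by (cases e) (simp add: edge_flow_def)
  define R where "R e = Ent \<mu> (expected_load M \<gamma> \<mu> w e)
      + mean \<mu> (expected_load M \<gamma> \<mu> w e) * ln ((exp 1)\<^sup>2 + 1)" for e
  define B where "B = Max ((\<lambda>e. 1 / (edge_flow q \<mu> e * w e) * R e) ` E)"
  have "log_sobolev_const E q \<mu> \<le> B"
  proof (rule log_sobolev_const_le[OF assms(1) edge Q])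
    fix f
    have "Ent \<mu> (\<lambda>x. (f x)\<^sup>2) \<le> (\<Sum>e\<in>E. (edge_diff e f)\<^sup>2 / w e * R e)"
      unfolding R_def using assms w by (intro Ent_square_le_loads) auto
    also have "\<dots> \<le> (\<Sum>e\<in>E. B * ((edge_diff e f)\<^sup>2 * edge_flow q \<mu> e))"
    proof (rule sum_mono)
      fix e assume e: "e \<in> E"
      have "1 / (edge_flow q \<mu> e * w e) * R e \<le> B"
        unfolding B_def using e by (intro Max_ge) auto
      then have "R e / w e \<le> B * edge_flow q \<mu> e"
        using Q[OF e] w[OF e] by (simp add: field_simps)
      then have "(edge_diff e f)\<^sup>2 * (R e / w e) \<le> (edge_diff e f)\<^sup>2 * (B * edge_flow q \<mu> e)"
        by (rule mult_left_mono) simp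
      then show "(edge_diff e f)\<^sup>2 / w e * R e \<le> B * ((edge_diff e f)\<^sup>2 * edge_flow q \<mu> e)"
        by (simp add: algebra_simps)
    qed
    also have "\<dots> = 2 * B * dirichlet E q \<mu> f"
      by (simp add: dirichlet_def sum_distrib_left)
    finally show "Ent \<mu> (\<lambda>x. (f x)\<^sup>2) \<le> 2 * B * dirichlet E q \<mu> f" .
  qed
  then show "log_sobolev_const E q \<mu> \<le> Max ((\<lambda>e. 1 / (edge_flow q \<mu> e * w e) *
        (Ent \<mu> (expected_load M \<gamma> \<mu> w e)
          + mean \<mu> (expected_load M \<gamma> \<mu> w e) * ln ((exp 1)\<^sup>2 + 1))) ` E)"
    by (simp only: B_def R_def)
qed

end
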